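(* For every positive integer $\mu$ there exists a chordal graph $G$ such that no set of at most $\mu$ spanning trees of $G$ collectively $+3$-spans $G$.
   Context: All graphs are connected, finite, undirected, loopless and without multiple edges; $\mathrm{dist}_G(u,v)$ is the number of edges of a shortest path between $u$ and $v$ in $G$. For $c\ge 0$, a set $\mathcal{T}$ of spanning trees of a graph $G$ collectively $+c$-spans $G$ if for any two vertices $u,v$ of $G$ there is a tree $T\in\mathcal{T}$ with $\mathrm{dist}_T(u,v)\le \mathrm{dist}_G(u,v)+c$. A graph is chordal if it does not contain any induced cycle of length greater than 3. *)

theory Defs
  imports "Graph_Theory.Graph_Theory"
begin

text \<open>
  An undirected graph is a symmetric, loop-free, finite digraph without parallel arcs
  (locale \<^locale>\<open>pair_graph\<close>): the edge \<open>{u, v}\<close> is the pair of arcs \<open>(u, v)\<close> and \<open>(v, u)\<close>.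
  Note that \<^const>\<open>connected\<close> excludes the graph without vertices.
\<close>

definition connected_graph :: "'a pair_pre_digraph \<Rightarrow> bool" where
  "connected_graph G \<longleftrightarrow> pair_graph G \<and> connected (with_proj G)"

definition graph_dist :: "'a pair_pre_digraph \<Rightarrow> 'a \<Rightarrow> 'a \<Rightarrow> nat" where
  "graph_dist G u v = (LEAST n. \<exists>p. pre_digraph.apath (with_proj G) u p v \<and> length p = n)"

text \<open>
  In a symmetric digraph the closed walk \<open>u, v, u\<close> is a \<^const>\<open>pre_digraph.cycle\<close>, although
  it is not a cycle of the undirected graph; the latter are the cycles of length at least 3.
  For this reason \<^const>\<open>tree\<close> and \<^const>\<open>spanning_tree\<close> are not the undirected notions
  and cannot be used.
\<close>

definition undirected_cycle :: "'a pair_pre_digraph \<Rightarrow> ('a \<times> 'a) awalk \<Rightarrow> bool" where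
  "undirected_cycle G p \<longleftrightarrow> pre_digraph.cycle (with_proj G) p \<and> 3 \<le> length p"

definition undirected_tree :: "'a pair_pre_digraph \<Rightarrow> bool" where
  "undirected_tree T \<longleftrightarrow> connected_graph T \<and> \<not> (\<exists>p. undirected_cycle T p)"

definition undirected_spanning_tree ::
    "'a pair_pre_digraph \<Rightarrow> 'a pair_pre_digraph \<Rightarrow> bool" where
  "undirected_spanning_tree T G \<longleftrightarrow> undirected_tree T \<and> spanning (with_proj T) (with_proj G)"

definition cycle_graph :: "nat \<Rightarrow> 'a pair_pre_digraph \<Rightarrow> bool" where
  "cycle_graph n C \<longleftrightarrow> pair_graph C \<and>
     (\<exists>p. undirected_cycle C p \<and> length p = n \<and>
          pverts C = fst ` set p \<and> parcs C = set p \<union> (set p)\<inverse>)"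

definition chordal :: "'a pair_pre_digraph \<Rightarrow> bool" where
  "chordal G \<longleftrightarrow>
     \<not> (\<exists>C n. induced_subgraph (with_proj C) (with_proj G) \<and> cycle_graph n C \<and> n > 3)"

definition collectively_spans ::
    "nat \<Rightarrow> 'a pair_pre_digraph set \<Rightarrow> 'a pair_pre_digraph \<Rightarrow> bool" where
  "collectively_spans c \<T> G \<longleftrightarrow>
     (\<forall>T\<in>\<T>. undirected_spanning_tree T G) \<and>
     (\<forall>u\<in>pverts G. \<forall>v\<in>pverts G. \<exists>T\<in>\<T>. graph_dist T u v \<le> graph_dist G u v + c)"

end

theory Submission
  imports Defs "HOL-Library.Ramsey"
begin

text \<open>
  The graph is built by repeatedly attaching many copies of a new vertex to a clique consisting of
  ancestors, for every possible choice; it is chordal since a deepest vertex of an induced cycle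
  would have adjacent neighbours. Given \<open>\<mu>\<close> spanning trees, walk down through the construction. Two
  disjoint sets of descendants cannot both connect the same two ancestors in a tree, so with
  enough copies one can always move to a copy below which no tree connects two of its attachment
  vertices; in particular, it has at most one neighbour above itself in each tree. An ancestor
  is dropped from the cliques once it has \<open>2\<mu>\<close> neighbours along the walk in some tree, which by
  counting happens to at most half of the vertices. The others form a large clique. By Ramsey's
  theorem it contains more than \<open>\<mu>\<close> vertices that have pairwise distance at least 4 in each tree:
  a large subset with pairwise odd distances is impossible in a bipartite graph, and a large one
  with pairwise distance 2 would have a common centre with too many neighbours. A new vertex
  attached to exactly these reaches, in each tree, at most one of them without passing through
  another, so one of its neighbours is at distance at least 5 from it in all trees.
\<close>

section \<open>Forests\<close>

text \<open>Acyclicity without walks: two distinct neighbours of \<open>y\<close> joined off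
  \<open>y\<close> would close a cycle through \<open>y\<close>. This form speaks of arcs only, so
  it transfers along injective relabellings.\<close>

definition forest_rel :: "'a rel \<Rightarrow> bool" where
  "forest_rel E \<longleftrightarrow> sym E \<and>
     (\<forall>y a b. (y, a) \<in> E \<longrightarrow> (y, b) \<in> E \<longrightarrow> a \<noteq> b \<longrightarrow> (a, b) \<notin> (E \<inter> (- {y}) \<times> (- {y}))\<^sup>*)"

lemma forest_relD:
  "\<lbrakk>forest_rel E; (y, a) \<in> E; (y, b) \<in> E; (a, b) \<in> (E \<inter> (- {y}) \<times> (- {y}))\<^sup>*\<rbrakk> \<Longrightarrow> a = b"
  unfolding forest_rel_def by blast

lemma forest_rel_sym: "\<lbrakk>forest_rel E; (a, b) \<in> E\<rbrakk> \<Longrightarrow> (b, a) \<in> E"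
  unfolding forest_rel_def sym_def by blast

text \<open>Colour by the parity of the distance \<open>d\<close> from \<open>r\<close>. An arc
  between \<open>u\<close> and \<open>v\<close> on the same level is impossible: the predecessor
  \<open>a\<close> of \<open>u\<close> on a shortest walk and \<open>v\<close> are distinct
  neighbours of \<open>u\<close>, both joined to \<open>r\<close> off \<open>u\<close>.\<close>

lemma forest_rel_bipartite:
  assumes E: "forest_rel E" and irr: "irrefl E" and conn: "\<And>v. v \<in> Field E \<Longrightarrow> (r, v) \<in> E\<^sup>*"
  shows "\<exists>col :: 'a \<Rightarrow> bool. \<forall>(u, v) \<in> E. col u \<noteq> col v"
proof -
  define d where "d v = (LEAST n. (r, v) \<in> E ^^ n)" for v
  have attained: "(r, v) \<in> E ^^ d v" if "(r, v) \<in> E\<^sup>*" for v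
    unfolding d_def using that by (metis LeastI_ex rtrancl_imp_relpow)
  have least: "d v \<le> n" if "(r, v) \<in> E ^^ n" for v n
    unfolding d_def using that by (rule Least_le)
  have step: "d v \<le> Suc (d u)" if "(u, v) \<in> E" for u v
    by (rule least) (meson FieldI1 attained conn relpow_Suc_I that)
  \<comment> \<open>A walk from \<open>r\<close> of length at most \<open>d u\<close> can meet
    \<open>u\<close> only as its last vertex.\<close>
  have avoid: "(r, v) \<in> (E \<inter> (- {u}) \<times> (- {u}))\<^sup>*" if "(r, v) \<in> E ^^ n" "n \<le> d u" "v \<noteq> u" for u v n
    using that
  proof (induction n arbitrary: v)
    case 0
    then show ?case by simp
  next
    case (Suc n)
    then obtain w where w: "(r, w) \<in> E ^^ n" "(w, v) \<in> E"
      by auto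
    have "w \<noteq> u"
      using least[OF w(1)] Suc.prems(2) by auto
    with Suc w have "(r, w) \<in> (E \<inter> (- {u}) \<times> (- {u}))\<^sup>*"
      by simp
    with w \<open>w \<noteq> u\<close> Suc.prems(3) show ?case
      by (simp add: rtrancl.rtrancl_into_rtrancl)
  qed
  have neq: "d u \<noteq> d v" if uv: "(u, v) \<in> E" for u v
  proof
    assume eq: "d u = d v"
    have u: "(r, u) \<in> E ^^ d u" and v: "(r, v) \<in> E ^^ d v"
      using attained conn uv by (auto simp: Field_def)
    have "u \<noteq> v"
      using uv irr by (auto simp: irrefl_def)
    then have "d u \<noteq> 0"
      using u v eq by (metis relpow_0_E)
    then obtain n where n: "d u = Suc n"
      using not0_implies_Suc by blast
    then obtain a where a: "(r, a) \<in> E ^^ n" "(a, u) \<in> E"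
      using u by auto
    have "a \<noteq> u" "a \<noteq> v"
      using least[OF a(1)] n eq by auto
    have ra: "(r, a) \<in> (E \<inter> (- {u}) \<times> (- {u}))\<^sup>*"
      using avoid[OF a(1)] n \<open>a \<noteq> u\<close> by simp
    have rv: "(r, v) \<in> (E \<inter> (- {u}) \<times> (- {u}))\<^sup>*"
      using avoid[OF v] eq \<open>u \<noteq> v\<close> by simp
    have "sym ((E \<inter> (- {u}) \<times> (- {u}))\<^sup>*)"
      using E by (intro sym_rtrancl) (auto simp: forest_rel_def sym_def)
    then have "(a, v) \<in> (E \<inter> (- {u}) \<times> (- {u}))\<^sup>*"
      using ra rv by (meson rtrancl_trans symD)
    then have "a = v"
      using forest_relD[OF E _ uv] forest_rel_sym[OF E a(2)] by blast
    with \<open>a \<noteq> v\<close> show False ..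
  qed
  have "even (d u) \<noteq> even (d v)" if uv: "(u, v) \<in> E" for u v
  proof -
    have "d v = Suc (d u) \<or> d u = Suc (d v)"
      using step[OF uv] step[OF forest_rel_sym[OF E uv]] neq[OF uv] by linarith
    then show ?thesis by auto
  qed
  then show ?thesis
    by (intro exI[of _ "\<lambda>v. even (d v)"]) auto
qed

lemma bipartite_relpow:
  assumes col: "\<And>u v. (u, v) \<in> E \<Longrightarrow> col u \<noteq> (col v :: bool)" and "(u, v) \<in> E ^^ n"
  shows "col u = col v \<longleftrightarrow> even n"
  using assms(2)
proof (induction n arbitrary: v)
  case (Suc n)
  then obtain w where "(u, w) \<in> E ^^ n" "(w, v) \<in> E"
    by auto
  with Suc.IH[of w] col[of w v] show ?case by auto
qed simp

text \<open>All of \<open>H\<close> has one colour, so no common neighbour lies in \<open>H\<close>.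
  For distinct \<open>x\<close>, \<open>y\<close>, \<open>z\<close> the middle vertices of
  \<open>x\<close>, \<open>y\<close> and of \<open>y\<close>, \<open>z\<close> are neighbours of
  \<open>y\<close> joined off \<open>y\<close> through \<open>x\<close>, the middle vertex of
  \<open>x\<close>, \<open>z\<close>, and \<open>z\<close>; hence they coincide.\<close>

lemma forest_rel_common_centre:
  assumes E: "forest_rel E" and col: "\<And>u v. (u, v) \<in> E \<Longrightarrow> col u \<noteq> (col v :: bool)"
    and H: "finite H" "3 \<le> card H"
    and common: "\<And>x y. \<lbrakk>x \<in> H; y \<in> H; x \<noteq> y\<rbrakk> \<Longrightarrow> \<exists>w. (x, w) \<in> E \<and> (w, y) \<in> E"
  shows "\<exists>w. \<forall>x \<in> H. (x, w) \<in> E"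
proof -
  have coleq: "col x = col y" if xy: "x \<in> H" "y \<in> H" for x y
  proof (cases "x = y")
    case False
    then obtain w where "(x, w) \<in> E" "(w, y) \<in> E"
      using common[OF xy] by blast
    then show ?thesis
      using col[of x w] col[of w y] by simp
  qed simp
  have centre: "w = w'" if H: "x \<in> H" "y \<in> H" "z \<in> H" "x \<noteq> y" "y \<noteq> z" "x \<noteq> z"
    and arcs: "(x, w) \<in> E" "(w, y) \<in> E" "(y, w') \<in> E" "(w', z) \<in> E" for x y z w w'
  proof -
    obtain v where v: "(x, v) \<in> E" "(v, z) \<in> E"
      using common[OF H(1,3,6)] by blast
    let ?R = "E \<inter> (- {y}) \<times> (- {y})"
    have "w \<noteq> y" "w' \<noteq> y" "v \<noteq> y"
      using col[OF arcs(2)] col[OF arcs(3)] col[OF v(1)] coleq[OF H(1,2)] by auto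
    then have "(w, x) \<in> ?R" "(x, v) \<in> ?R" "(v, z) \<in> ?R" "(z, w') \<in> ?R"
      using H(4-6) arcs v by (auto intro: forest_rel_sym[OF E])
    then have "(w, w') \<in> ?R\<^sup>*"
      by (meson converse_rtrancl_into_rtrancl rtrancl.rtrancl_refl)
    then show ?thesis
      using forest_relD[OF E forest_rel_sym[OF E arcs(2)] arcs(3)] by blast
  qed
  obtain S where "S \<subseteq> H" "card S = 3"
    using H(2) by (rule obtain_subset_with_card_n)
  then obtain x y z where xyz: "x \<in> H" "y \<in> H" "z \<in> H" "x \<noteq> y" "y \<noteq> z" "x \<noteq> z"
    by (auto simp: card_3_iff)
  obtain w where w: "(x, w) \<in> E" "(w, y) \<in> E"
    using common xyz by blast
  have "(t, w) \<in> E" if t: "t \<in> H" for t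
  proof (cases "t = x \<or> t = y")
    case True
    then show ?thesis using w forest_rel_sym[OF E] by blast
  next
    case False
    then obtain w' where w': "(y, w') \<in> E" "(w', t) \<in> E"
      using common[of y t] xyz t by blast
    have "w = w'"
      by (rule centre[of x y t]) (use xyz t w w' False in auto)
    then show ?thesis using w' forest_rel_sym[OF E] by blast
  qed
  then show ?thesis by blast
qed

section \<open>Connections through disjoint vertex sets\<close>

text \<open>A walk from \<open>y\<close> to \<open>y'\<close> whose interior is nonempty and stays
  in \<open>D\<close>; a direct arc does not count.\<close>

definition linked :: "'a rel \<Rightarrow> 'a set \<Rightarrow> 'a \<Rightarrow> 'a \<Rightarrow> bool" where
  "linked E D y y' \<longleftrightarrow>
     (\<exists>z \<in> D. \<exists>z' \<in> D. (y, z) \<in> E \<and> (z, z') \<in> (E \<inter> D \<times> D)\<^sup>* \<and> (z', y') \<in> E)"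

lemma linkedI_common: "\<lbrakk>z \<in> D; (y, z) \<in> E; (z, y') \<in> E\<rbrakk> \<Longrightarrow> linked E D y y'"
  unfolding linked_def by blast

text \<open>
  If both \<open>D\<close> and \<open>D'\<close> linked \<open>y\<close> and \<open>y'\<close>, the two connections would form a cycle.
\<close>
lemma forest_rel_linked_once:
  assumes E: "forest_rel E" and "linked E D y y'" "linked E D' y y'"
    and "D \<inter> D' = {}" "y \<notin> D" "y \<notin> D'" "y \<noteq> y'"
  shows False
proof -
  obtain z1 z2 where z: "z1 \<in> D" "z2 \<in> D" "(y, z1) \<in> E" "(z1, z2) \<in> (E \<inter> D \<times> D)\<^sup>*" "(z2, y') \<in> E"
    using assms(2) unfolding linked_def by blast
  obtain w1 w2 where w: "w1 \<in> D'" "w2 \<in> D'" "(y, w1) \<in> E" "(w1, w2) \<in> (E \<inter> D' \<times> D')\<^sup>*" "(w2, y') \<in> E"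
    using assms(3) unfolding linked_def by blast
  let ?R = "E \<inter> (- {y}) \<times> (- {y})"
  have "sym (?R\<^sup>*)"
    using E by (intro sym_rtrancl) (auto simp: forest_rel_def sym_def)
  have "(z1, z2) \<in> ?R\<^sup>*"
    using z(4) by (rule rev_subsetD[OF _ rtrancl_mono]) (use assms in blast)
  moreover have "(w1, w2) \<in> ?R\<^sup>*"
    using w(4) by (rule rev_subsetD[OF _ rtrancl_mono]) (use assms in blast)
  moreover have "(z2, y') \<in> ?R" "(w2, y') \<in> ?R"
    using z w assms by auto
  ultimately have "(z1, y') \<in> ?R\<^sup>*" "(w1, y') \<in> ?R\<^sup>*"
    by (meson rtrancl.rtrancl_into_rtrancl)+
  then have "(z1, w1) \<in> ?R\<^sup>*"
    using \<open>sym (?R\<^sup>*)\<close> by (meson rtrancl_trans symD)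
  then have "z1 = w1"
    using forest_relD[OF E] z w by blast
  then show False
    using z w assms by blast
qed

text \<open>Pigeonhole: a bad copy yields a triple of a forest and two distinct vertices of
  \<open>Q\<close> that it links. There are fewer triples than copies, so two copies share one,
  against \<open>forest_rel_linked_once\<close>.\<close>

lemma exists_unlinked_copy:
  assumes \<E>: "finite \<E>" "card \<E> \<le> \<mu>" "\<And>E. E \<in> \<E> \<Longrightarrow> forest_rel E"
    and Q: "finite Q" "\<mu> * (card Q)\<^sup>2 < N"
    and D: "\<And>a b. \<lbrakk>a < N; b < N; a \<noteq> b\<rbrakk> \<Longrightarrow> D a \<inter> D b = {}" "\<And>a. a < N \<Longrightarrow> D a \<inter> Q = {}"
  shows "\<exists>a<N. \<forall>E \<in> \<E>. \<forall>y \<in> Q. \<forall>y' \<in> Q. linked E (D a) y y' \<longrightarrow> y = y'"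
proof (rule ccontr)
  assume "\<not> ?thesis"
  then have "\<exists>t. t \<in> \<E> \<times> Q \<times> Q \<and>
      linked (fst t) (D a) (fst (snd t)) (snd (snd t)) \<and> fst (snd t) \<noteq> snd (snd t)" if "a < N" for a
    using that by force
  then obtain f where f: "\<And>a. a < N \<Longrightarrow> f a \<in> \<E> \<times> Q \<times> Q \<and>
      linked (fst (f a)) (D a) (fst (snd (f a))) (snd (snd (f a))) \<and> fst (snd (f a)) \<noteq> snd (snd (f a))"
    by metis
  have "card (\<E> \<times> Q \<times> Q) \<le> \<mu> * (card Q)\<^sup>2"
    using \<E> by (simp add: card_cartesian_product power2_eq_square)
  then have "card (f ` {..<N}) < card {..<N}"
    using card_mono[of "\<E> \<times> Q \<times> Q" "f ` {..<N}"] f \<E> Q by fastforce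
  then obtain a b where ab: "a < N" "b < N" "a \<noteq> b" "f a = f b"
    using pigeonhole unfolding inj_on_def by blast
  obtain E y y' where t: "f a = (E, y, y')"
    by (metis prod_cases3)
  then have "E \<in> \<E>" "y \<in> Q" "y \<noteq> y'" "linked E (D a) y y'" "linked E (D b) y y'"
    using f[OF ab(1)] f[OF ab(2)] ab(4) by simp_all
  moreover have "y \<notin> D a" "y \<notin> D b"
    using D(2)[OF ab(1)] D(2)[OF ab(2)] \<open>y \<in> Q\<close> by blast+
  ultimately show False
    using forest_rel_linked_once[OF \<E>(3)] D(1)[OF ab(1-3)] by blast
qed

text \<open>The walk is cut at its first exit from \<open>D\<close>. The exit arc itself costs a
  step, hence the strict \<open>k < n\<close>.\<close>

lemma relpow_exit:
  assumes "(c, y) \<in> E ^^ n" "c \<in> D" "y \<notin> D"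
  shows "\<exists>z p k. z \<in> D \<and> (c, z) \<in> (E \<inter> D \<times> D)\<^sup>* \<and> (z, p) \<in> E \<and> p \<notin> D \<and> (p, y) \<in> E ^^ k \<and> k < n"
  using assms(1,2)
proof (induction n arbitrary: c)
  case 0
  with assms(3) show ?case by simp
next
  case (Suc n)
  then obtain e where e: "(c, e) \<in> E" "(e, y) \<in> E ^^ n"
    by (meson relpow_Suc_D2)
  show ?case
  proof (cases "e \<in> D")
    case True
    with Suc e obtain z p k where "z \<in> D" "(e, z) \<in> (E \<inter> D \<times> D)\<^sup>*" "(z, p) \<in> E" "p \<notin> D"
      "(p, y) \<in> E ^^ k" "k < n" by blast
    moreover have "(c, e) \<in> E \<inter> D \<times> D"
      using e True Suc by blast
    ultimately show ?thesis
      by (meson converse_rtrancl_into_rtrancl less_Suc_eq)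
  next
    case False
    with e Suc.prems show ?thesis by blast
  qed
qed

section \<open>Ramsey's theorem for several relations\<close>

text \<open>One application of two-colour Ramsey per relation: cliques of size \<open>q\<close> are
  excluded, so a large independent set remains, and the induction hypothesis handles the other
  relations inside it.\<close>

lemma ramsey_cocliques:
  "\<exists>M. \<forall>(V :: 'a set) \<P>. finite V \<and> M \<le> card V \<and> finite \<P> \<and> card \<P> \<le> k \<and>
     (\<forall>P \<in> \<P>. \<forall>x y. P x y \<longrightarrow> P y x) \<and>
     (\<forall>P \<in> \<P>. \<forall>H \<subseteq> V. card H = q \<longrightarrow> (\<exists>x \<in> H. \<exists>y \<in> H. x \<noteq> y \<and> \<not> P x y)) \<longrightarrow>
     (\<exists>H \<subseteq> V. card H = q \<and> (\<forall>P \<in> \<P>. \<forall>x \<in> H. \<forall>y \<in> H. x \<noteq> y \<longrightarrow> \<not> P x y))"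
  (is "\<exists>M. ?bound k M")
proof (induction k)
  case 0
  show ?case
  proof (intro exI[of _ q] allI impI, elim conjE)
    fix V :: "'a set" and \<P> :: "('a \<Rightarrow> 'a \<Rightarrow> bool) set"
    assume V: "q \<le> card V" and "finite \<P>" "card \<P> \<le> 0"
    then have "\<P> = {}"
      by simp
    with V show "\<exists>H \<subseteq> V. card H = q \<and> (\<forall>P \<in> \<P>. \<forall>x \<in> H. \<forall>y \<in> H. x \<noteq> y \<longrightarrow> \<not> P x y)"
      by (auto elim: obtain_subset_with_card_n)
  qed
next
  case (Suc k)
  then obtain M where M: "?bound k M" ..
  obtain r where r: "\<And>(V :: 'a set) (E :: 'a set set). \<lbrakk>finite V; r \<le> card V\<rbrakk> \<Longrightarrow>
      \<exists>R \<subseteq> V. card R = q \<and> clique R E \<or> card R = max M q \<and> indep R E"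
    using ramsey2[of q "max M q"] by metis
  \<comment> \<open>The \<open>q\<close> in the maximum serves the case of an empty family.\<close>
  show ?case
  proof (intro exI[of _ "max r q"] allI impI, elim conjE)
    fix V :: "'a set" and \<P>
    assume V: "finite V" "max r q \<le> card V" and \<P>: "finite \<P>" "card \<P> \<le> Suc k"
      and sym: "\<forall>P \<in> \<P>. \<forall>x y. P x y \<longrightarrow> P y x"
      and noc: "\<forall>P \<in> \<P>. \<forall>H \<subseteq> V. card H = q \<longrightarrow> (\<exists>x \<in> H. \<exists>y \<in> H. x \<noteq> y \<and> \<not> P x y)"
    show "\<exists>H \<subseteq> V. card H = q \<and> (\<forall>P \<in> \<P>. \<forall>x \<in> H. \<forall>y \<in> H. x \<noteq> y \<longrightarrow> \<not> P x y)"
    proof (cases "\<P> = {}")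
      case True
      then show ?thesis using V obtain_subset_with_card_n[of q V] by auto
    next
      case False
      then obtain P where P: "P \<in> \<P>" by blast
      define F where "F = {{x, y} | x y. P x y}"
      have F: "{x, y} \<in> F \<longleftrightarrow> P x y" for x y
        unfolding F_def using sym P by (auto simp: doubleton_eq_iff)
      obtain R where R: "R \<subseteq> V" "card R = q \<and> clique R F \<or> card R = max M q \<and> indep R F"
        using r[of V F] V by auto
      then have card: "card R = max M q" and ind: "\<And>x y. \<lbrakk>x \<in> R; y \<in> R; x \<noteq> y\<rbrakk> \<Longrightarrow> \<not> P x y"
      proof -
        have "\<not> (card R = q \<and> clique R F)"
          using noc P F R(1) unfolding clique_def by blast
        then show "card R = max M q" "\<And>x y. \<lbrakk>x \<in> R; y \<in> R; x \<noteq> y\<rbrakk> \<Longrightarrow> \<not> P x y"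
          using R(2) F unfolding indep_def by blast+
      qed
      have "\<exists>H \<subseteq> R. card H = q \<and> (\<forall>P \<in> \<P> - {P}. \<forall>x \<in> H. \<forall>y \<in> H. x \<noteq> y \<longrightarrow> \<not> P x y)"
      proof (rule M[THEN spec, THEN spec, THEN mp], intro conjI)
        show "finite R"
          using R(1) V(1) by (rule finite_subset)
        show "M \<le> card R" "finite (\<P> - {P})" "card (\<P> - {P}) \<le> k"
          using card \<P> P by simp_all
        show "\<forall>P \<in> \<P> - {P}. \<forall>x y. P x y \<longrightarrow> P y x"
          using sym by blast
        show "\<forall>P \<in> \<P> - {P}. \<forall>H \<subseteq> R. card H = q \<longrightarrow> (\<exists>x \<in> H. \<exists>y \<in> H. x \<noteq> y \<and> \<not> P x y)"
          using noc R(1) by (meson DiffD1 subset_trans)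
      qed
      then obtain H where "H \<subseteq> R" "card H = q"
        and H: "\<forall>P \<in> \<P> - {P}. \<forall>x \<in> H. \<forall>y \<in> H. x \<noteq> y \<longrightarrow> \<not> P x y"
        by (elim exE conjE)
      have "\<not> P' x y" if "P' \<in> \<P>" "x \<in> H" "y \<in> H" "x \<noteq> y" for P' x y
      proof (cases "P' = P")
        case True
        then show ?thesis
          using ind[of x y] that \<open>H \<subseteq> R\<close> by auto
      next
        case False
        then show ?thesis
          using H[THEN bspec, of P'] that by simp
      qed
      then have "\<forall>P \<in> \<P>. \<forall>x \<in> H. \<forall>y \<in> H. x \<noteq> y \<longrightarrow> \<not> P x y"
        by (intro ballI impI)
      moreover have "H \<subseteq> V"
        using \<open>H \<subseteq> R\<close> R(1) by (rule subset_trans)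
      ultimately show ?thesis
        using \<open>card H = q\<close> by (intro exI conjI)
    qed
  qed
qed

section \<open>Vertices and adjacency\<close>

type_synonym node = "(nat set \<times> nat) list"

text \<open>
  A vertex is a path in a rooted tree. Its last entry \<open>(B, k)\<close> says that it is copy number \<open>k\<close> of
  the child that, together with all its descendants, is not adjacent to the ancestors at depths in
  \<open>B\<close>; a parent remains adjacent to its child even if its depth is in \<open>B\<close>.
\<close>
definition attached :: "nat \<Rightarrow> node \<Rightarrow> bool" where
  "attached j v \<longleftrightarrow> j < length v \<and> (\<forall>b \<in> set (drop (Suc j) v). j \<notin> fst b)"

text \<open>Not all ancestors of \<open>v\<close>, only those adjacent to it; called attachment
  vertices of \<open>v\<close> below.\<close>

definition anc :: "node \<Rightarrow> node \<Rightarrow> bool" where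
  "anc u v \<longleftrightarrow> attached (length u) v \<and> take (length u) v = u"

definition nodes :: "nat \<Rightarrow> nat \<Rightarrow> node set" where
  "nodes m N = {v. length v \<le> m \<and> set v \<subseteq> Pow {..<m} \<times> {..<N}}"

definition node_arcs :: "nat \<Rightarrow> nat \<Rightarrow> node rel" where
  "node_arcs m N = {(u, v). u \<in> nodes m N \<and> v \<in> nodes m N \<and> (anc u v \<or> anc v u)}"

text \<open>The whole subtree rooted at \<open>v\<close>, with \<open>v\<close> itself.\<close>

definition desc :: "node \<Rightarrow> node set" where
  "desc v = {z. take (length v) z = v}"

lemma attached_append:
  "j < length u \<Longrightarrow> attached j (u @ w) \<longleftrightarrow> attached j u \<and> (\<forall>b \<in> set w. j \<notin> fst b)"
  unfolding attached_def by auto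

lemma attached_nth:
  "attached j v \<longleftrightarrow> j < length v \<and> (\<forall>k. j < k \<and> k < length v \<longrightarrow> j \<notin> fst (v ! k))"
proof -
  have "(\<forall>b \<in> set (drop (Suc j) v). j \<notin> fst b) \<longleftrightarrow>
      (\<forall>i < length v - Suc j. j \<notin> fst (v ! (Suc j + i)))" if "j < length v"
    using that by (auto simp: all_set_conv_all_nth)
  also have "(\<forall>i < length v - Suc j. j \<notin> fst (v ! (Suc j + i))) \<longleftrightarrow>
      (\<forall>k. j < k \<and> k < length v \<longrightarrow> j \<notin> fst (v ! k))"
  proof (intro iffI allI impI)
    fix k assume "\<forall>i < length v - Suc j. j \<notin> fst (v ! (Suc j + i))" "j < k \<and> k < length v"
    then show "j \<notin> fst (v ! k)"
      by (elim allE[of _ "k - Suc j"]) auto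
  qed auto
  finally show ?thesis
    unfolding attached_def by blast
qed

lemma anc_length: "anc u v \<Longrightarrow> length u < length v"
  unfolding anc_def attached_def by blast

lemma anc_parent: "anc x (x @ [b])"
  unfolding anc_def attached_def by simp

text \<open>Bans accumulate along a path, so a vertex above \<open>c\<close> that is adjacent to
  some descendant of \<open>c\<close> is already adjacent to \<open>c\<close>. Thus edges leaving
  the subtree of \<open>c\<close> end in attachment vertices of \<open>c\<close>.\<close>

lemma anc_desc:
  assumes "anc u z" "z \<in> desc c" "length u < length c"
  shows "anc u c"
proof -
  have z: "z = c @ drop (length c) z"
    using assms(2) unfolding desc_def by (metis append_take_drop_id mem_Collect_eq)
  then have "attached (length u) c"
    using assms(1,3) attached_append[of "length u" c] unfolding anc_def by metis
  moreover have "take (length u) c = u"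
    using assms z unfolding anc_def by (metis order.strict_implies_order take_append append_Nil2 diff_is_0_eq take0)
  ultimately show ?thesis
    unfolding anc_def by blast
qed

lemma anc_imp_desc: "anc u v \<Longrightarrow> v \<in> desc u"
  unfolding anc_def desc_def by blast

lemma desc_trans: "\<lbrakk>v \<in> desc u; z \<in> desc v; length u \<le> length v\<rbrakk> \<Longrightarrow> z \<in> desc u"
  unfolding desc_def by (metis (mono_tags) mem_Collect_eq min.absorb1 take_take)

lemma desc_length: "z \<in> desc v \<Longrightarrow> length v \<le> length z"
  unfolding desc_def by (metis (mono_tags) mem_Collect_eq length_take min.cobounded1 min_def)

text \<open>The longer of the two has \<open>w\<close> as a descendant, so \<open>anc_desc\<close>
  applies to the shorter one.\<close>

lemma anc_clique:
  assumes "anc u w" "anc v w" "u \<noteq> v"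
  shows "anc u v \<or> anc v u"
proof -
  have "length u \<noteq> length v"
    using assms unfolding anc_def by metis
  then show ?thesis
    using anc_desc[of u w v] anc_desc[of v w u] assms anc_imp_desc by fastforce
qed

text \<open>All copies of a child have the same attachment vertices, so one set \<open>Q\<close>
  serves for the pigeonhole argument.\<close>

lemma anc_append_cong: "anc u (x @ [(B, k)]) \<longleftrightarrow> anc u (x @ [(B, k')])"
proof -
  have "attached j (x @ [(B, k)]) \<longleftrightarrow> attached j (x @ [(B, k')])" for j
  proof (cases "j < length x")
    case True
    then show ?thesis by (simp add: attached_append)
  qed (auto simp: attached_def)
  moreover have "attached (length u) (x @ [(B, k)]) \<Longrightarrow> length u \<le> length x"
    by (auto simp: attached_def)
  ultimately show ?thesis
    unfolding anc_def by auto
qed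

lemma finite_nodes: "finite (nodes m N)"
proof -
  have "nodes m N = {v. set v \<subseteq> Pow {..<m} \<times> {..<N} \<and> length v \<le> m}"
    unfolding nodes_def by blast
  then show ?thesis
    by (simp add: finite_lists_length_le)
qed

lemma take_in_nodes: "x \<in> nodes m N \<Longrightarrow> take j x \<in> nodes m N"
  unfolding nodes_def using set_take_subset by fastforce

lemma anc_finite: "finite {u. anc u v}" and card_anc: "card {u. anc u v} \<le> length v"
proof -
  have "{u. anc u v} \<subseteq> (\<lambda>j. take j v) ` {..<length v}"
  proof
    fix u assume "u \<in> {u. anc u v}"
    then have "length u \<in> {..<length v}" "u = take (length u) v"
      using anc_length unfolding anc_def by auto
    then show "u \<in> (\<lambda>j. take j v) ` {..<length v}"
      by blast
  qed
  then show "finite {u. anc u v}" "card {u. anc u v} \<le> length v"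
    by (auto intro: finite_subset surj_card_le[of "{..<length v}", simplified])
qed

section \<open>Descending through a family of trees\<close>

text \<open>Each tree is given by its arc relation, with a proper 2-colouring \<open>col\<close> for
  parity arguments. \<open>N\<close> exceeds the number of triples counted in
  \<open>exists_unlinked_copy\<close>, as a vertex has at most \<open>m\<close> attachment
  vertices.\<close>

locale tree_family =
  fixes m N \<mu> :: nat and \<E> :: "node rel set" and col :: "node rel \<Rightarrow> node \<Rightarrow> bool"
  assumes \<mu>: "0 < \<mu>" and N: "\<mu> * m\<^sup>2 < N"
    and family: "finite \<E>" "card \<E> \<le> \<mu>"
    and forest: "\<And>E. E \<in> \<E> \<Longrightarrow> forest_rel E"
    and arcs: "\<And>E. E \<in> \<E> \<Longrightarrow> E \<subseteq> node_arcs m N"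
    and col: "\<And>E u v. \<lbrakk>E \<in> \<E>; (u, v) \<in> E\<rbrakk> \<Longrightarrow> col E u \<noteq> col E v"
begin

lemma family_sym: "\<lbrakk>E \<in> \<E>; (u, v) \<in> E\<rbrakk> \<Longrightarrow> (v, u) \<in> E"
  by (rule forest_rel_sym[OF forest])

lemma family_anc: "\<lbrakk>E \<in> \<E>; (u, v) \<in> E\<rbrakk> \<Longrightarrow> anc u v \<or> anc v u"
  using arcs[of E] unfolding node_arcs_def by blast

text \<open>Since \<open>desc v\<close> contains \<open>v\<close>, this also says that
  \<open>v\<close> has at most one of its attachment vertices as a neighbour in each tree.\<close>

definition unlinked :: "node \<Rightarrow> bool" where
  "unlinked v \<longleftrightarrow>
     (\<forall>E \<in> \<E>. \<forall>y y'. anc y v \<longrightarrow> anc y' v \<longrightarrow> linked E (desc v) y y' \<longrightarrow> y = y')"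

lemma unlinkedD:
  "\<lbrakk>unlinked v; E \<in> \<E>; anc y v; anc y' v; linked E (desc v) y y'\<rbrakk> \<Longrightarrow> y = y'"
  unfolding unlinked_def by blast

lemma exists_unlinked_child:
  assumes "length x < m"
  shows "\<exists>k<N. unlinked (x @ [(B, k)])"
proof -
  let ?c = "\<lambda>k. x @ [(B, k)]"
  let ?Q = "{u. anc u (?c 0)}"
  have "card ?Q \<le> m"
    using card_anc[of "?c 0"] assms by simp
  then have "\<mu> * (card ?Q)\<^sup>2 < N"
    using N by (meson le_less_trans mult_le_mono2 power2_nat_le_eq_le)
  moreover have "desc (?c a) \<inter> desc (?c b) = {}" if "a \<noteq> b" for a b
    using that unfolding desc_def by auto
  moreover have "desc (?c a) \<inter> ?Q = {}" for a
    using anc_length desc_length by fastforce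
  ultimately obtain k where "k < N"
    "\<forall>E \<in> \<E>. \<forall>y \<in> ?Q. \<forall>y' \<in> ?Q. linked E (desc (?c k)) y y' \<longrightarrow> y = y'"
    using exists_unlinked_copy[OF family forest anc_finite, of "?c 0" N "\<lambda>k. desc (?c k)"] by auto
  then show ?thesis
    unfolding unlinked_def using anc_append_cong by blast
qed

section \<open>Balanced paths and overused vertices\<close>

definition usage :: "node rel \<Rightarrow> node \<Rightarrow> nat \<Rightarrow> nat \<Rightarrow> nat" where
  "usage E x l j = card {k. j < k \<and> k \<le> l \<and> (take j x, take k x) \<in> E}"

definition overused :: "node \<Rightarrow> nat \<Rightarrow> nat \<Rightarrow> bool" where
  "overused x l j \<longleftrightarrow> (\<exists>E \<in> \<E>. 2 * \<mu> \<le> usage E x l j)"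

text \<open>
  Along a path \<open>x\<close>, the entry added at step \<open>k\<close> bans all ancestors that already have \<open>2\<mu>\<close>
  neighbours further down the path in one of the trees.
\<close>
definition balanced :: "node \<Rightarrow> bool" where
  "balanced x \<longleftrightarrow> (\<forall>k < length x. fst (x ! k) = {j. j < k \<and> overused x k j}) \<and>
     (\<forall>k. 0 < k \<longrightarrow> k \<le> length x \<longrightarrow> unlinked (take k x))"

lemma overused_mono: "\<lbrakk>overused x l j; l \<le> l'\<rbrakk> \<Longrightarrow> overused x l' j"
proof -
  assume "overused x l j" "l \<le> l'"
  moreover have "usage E x l j \<le> usage E x l' j" for E
    unfolding usage_def using \<open>l \<le> l'\<close> by (intro card_mono) auto
  ultimately show ?thesis
    unfolding overused_def by (meson order_trans)
qed

lemma overused_cong: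
  assumes "l \<le> length x"
  shows "overused (x @ w) l j \<longleftrightarrow> overused x l j"
proof -
  have "usage E (x @ w) l j = usage E x l j" for E
    unfolding usage_def using assms by (intro arg_cong[where f = card]) auto
  then show ?thesis
    unfolding overused_def by simp
qed

lemma exists_balanced: "l \<le> m \<Longrightarrow> \<exists>x \<in> nodes m N. length x = l \<and> balanced x"
proof (induction l)
  case 0
  then show ?case
    by (intro bexI[of _ "[]"]) (auto simp: balanced_def nodes_def)
next
  case (Suc l)
  then obtain x where x: "x \<in> nodes m N" "length x = l" "balanced x"
    by auto
  \<comment> \<open>Usage up to depth \<open>l\<close> depends only on the first \<open>l\<close>
    entries, so the ban set is known before the new entry is chosen.\<close>
  define B where "B = {j. j < l \<and> overused x l j}"
  obtain k where k: "k < N" "unlinked (x @ [(B, k)])"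
    using exists_unlinked_child[of x B] x Suc.prems by auto
  let ?x = "x @ [(B, k)]"
  have "?x \<in> nodes m N"
    using x k Suc.prems unfolding nodes_def B_def by auto
  moreover have "balanced ?x"
    unfolding balanced_def
  proof (intro conjI allI impI)
    fix i assume "i < length ?x"
    then consider "i < l" | "i = l"
      using x by (auto simp: less_Suc_eq)
    then show "fst (?x ! i) = {j. j < i \<and> overused ?x i j}"
      by cases (use x in \<open>auto simp: nth_append overused_cong B_def balanced_def\<close>)
  next
    fix i assume i: "0 < i" "i \<le> length ?x"
    show "unlinked (take i ?x)"
    proof (cases "i \<le> l")
      case True
      then show ?thesis
        using x i unfolding balanced_def by auto
    next
      case False
      then show ?thesis
        using k i x by (simp add: take_Cons')
    qed
  qed
  ultimately show ?case
    using x by (intro bexI[of _ ?x]) auto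
qed

text \<open>The last entry of \<open>take l x\<close> has index \<open>l - 1\<close>, and by
  monotonicity its ban set contains the earlier bans. The boundary case \<open>j = l - 1\<close>
  holds because nothing is overused at its own depth.\<close>

lemma attached_balanced:
  assumes "balanced x" "l \<le> length x"
  shows "attached j (take l x) \<longleftrightarrow> j < l \<and> \<not> overused x (l - 1) j"
proof -
  have "\<not> overused x j j"
  proof -
    have "{k. j < k \<and> k \<le> j \<and> (take j x, take k x) \<in> E} = {}" for E :: "node rel"
      using not_le by blast
    then show ?thesis
      using \<mu> unfolding overused_def usage_def by (simp only: card.empty) simp
  qed
  have "attached j (take l x) \<longleftrightarrow> j < l \<and> (\<forall>k. j < k \<and> k < l \<longrightarrow> \<not> overused x k j)"
    using assms unfolding attached_nth balanced_def by auto
  also have "\<dots> \<longleftrightarrow> j < l \<and> \<not> overused x (l - 1) j"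
  proof (cases "j < l - 1")
    case True
    then show ?thesis
      using overused_mono[of x _ j "l - 1"] by fastforce
  next
    case False
    then have "j = l - 1" if "j < l"
      using that by simp
    then show ?thesis
      using \<open>\<not> overused x j j\<close> by auto
  qed
  finally show ?thesis .
qed

text \<open>A depth that is not overused at the end was never banned; such depths therefore form a
  clique along the path.\<close>

lemma anc_take_balanced:
  assumes "balanced x" "l \<le> length x" "j < l" "\<not> overused x (length x) j"
  shows "anc (take j x) (take l x)"
proof -
  have "l - 1 \<le> length x"
    using assms(2) by simp
  then have "attached j (take l x)"
    using assms attached_balanced[OF assms(1,2), of j] overused_mono by blast
  then show ?thesis
    using assms unfolding anc_def by (simp add: min_def)
qed

text \<open>Two such arcs would link two attachment vertices of \<open>take k x\<close> through
  \<open>take k x\<close> itself, which is unlinked.\<close>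

lemma balanced_unique_parent:
  assumes "balanced x" "E \<in> \<E>" "k \<le> length x" "j < k" "j' < k"
    and "(take j x, take k x) \<in> E" "(take j' x, take k x) \<in> E"
  shows "j = j'"
proof -
  have anc: "anc (take i x) (take k x)" if "i < k" "(take i x, take k x) \<in> E" for i
    using family_anc[OF assms(2) that(2)] anc_length[of "take k x" "take i x"] that assms(3) by auto
  have "linked E (desc (take k x)) (take j x) (take j' x)"
    using assms family_sym by (intro linkedI_common[of "take k x"]) (auto simp: desc_def)
  then have "take j x = take j' x"
    using assms anc by (intro unlinkedD[of "take k x" E]) (auto simp: balanced_def)
  then show ?thesis
    using assms(3-5) by (metis length_take less_imp_le_nat min.absorb2 order_trans)
qed

text \<open>In a fixed tree every depth \<open>k\<close> is counted for at most one
  \<open>j\<close>, by \<open>balanced_unique_parent\<close>. So at most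
  \<open>m / (2 * \<mu>)\<close> depths are overused in that tree; summing over at most
  \<open>\<mu>\<close> trees gives half of \<open>m\<close>.\<close>

lemma card_overused:
  assumes "balanced x" "length x = m"
  shows "2 * card {j. j < m \<and> overused x m j} \<le> m"
proof -
  define S where "S E = {j. j < m \<and> 2 * \<mu> \<le> usage E x m j}" for E
  have S: "2 * \<mu> * card (S E) \<le> m" if E: "E \<in> \<E>" for E
  proof -
    let ?U = "\<lambda>j. {k. j < k \<and> k \<le> m \<and> (take j x, take k x) \<in> E}"
    have "finite (S E)"
      unfolding S_def by simp
    have "2 * \<mu> * card (S E) = (\<Sum>j \<in> S E. 2 * \<mu>)"
      by simp
    also have "\<dots> \<le> (\<Sum>j \<in> S E. card (?U j))"
      by (intro sum_mono) (simp add: S_def usage_def)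
    also have "\<dots> = card (\<Union>j \<in> S E. ?U j)"
    proof (rule card_UN_disjoint[symmetric])
      show "\<forall>i \<in> S E. \<forall>j \<in> S E. i \<noteq> j \<longrightarrow> ?U i \<inter> ?U j = {}"
        using balanced_unique_parent[OF assms(1) E] assms(2) by auto
    qed (use \<open>finite (S E)\<close> in auto)
    also have "\<dots> \<le> card {1..m}"
      by (intro card_mono) auto
    finally show ?thesis by simp
  qed
  have "{j. j < m \<and> overused x m j} = (\<Union>E \<in> \<E>. S E)"
    unfolding S_def overused_def by blast
  then have "card {j. j < m \<and> overused x m j} \<le> (\<Sum>E \<in> \<E>. card (S E))"
    using family(1) by (simp add: card_UN_le)
  then have "2 * \<mu> * card {j. j < m \<and> overused x m j} \<le> (\<Sum>E \<in> \<E>. 2 * \<mu> * card (S E))"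
    by (simp add: sum_distrib_left[symmetric])
  also have "\<dots> \<le> (\<Sum>E \<in> \<E>. m)"
    by (intro sum_mono S)
  also have "\<dots> \<le> \<mu> * m"
    using family by simp
  finally have "\<mu> * (2 * card {j. j < m \<and> overused x m j}) \<le> \<mu> * m"
    by (simp add: mult.assoc mult.left_commute)
  then show ?thesis
    using \<mu> by simp
qed

text \<open>Otherwise all of \<open>H\<close> has a common neighbour \<open>w\<close> in the tree.
  If \<open>w\<close> lies below the deepest vertex of \<open>H\<close>, it links two other vertices
  of \<open>H\<close> through that subtree. If \<open>w\<close> lies above, it has too many
  neighbours along the path.\<close>

lemma no_common_neighbour_clique:
  assumes x: "balanced x" "length x = m" and E: "E \<in> \<E>"
    and H: "H \<subseteq> {j. j < m \<and> \<not> overused x m j}" "2 * \<mu> + 2 \<le> card H"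
  shows "\<exists>j \<in> H. \<exists>k \<in> H. j \<noteq> k \<and> \<not> (\<exists>w. (take j x, w) \<in> E \<and> (w, take k x) \<in> E)"
proof (rule ccontr)
  assume "\<not> ?thesis"
  then have common: "\<exists>w. (take j x, w) \<in> E \<and> (w, take k x) \<in> E" if "j \<in> H" "k \<in> H" "j \<noteq> k" for j k
    using that by blast
  have "finite H"
    using H(1) by (rule finite_subset) simp
  have inj: "inj_on (\<lambda>j. take j x) H"
    using H(1) x(2) by (intro inj_onI) (metis (no_types, lifting) length_take less_imp_le_nat mem_Collect_eq min.absorb2 subsetD)
  have "\<exists>w. \<forall>v \<in> (\<lambda>j. take j x) ` H. (v, w) \<in> E"
  proof (rule forest_rel_common_centre[OF forest[OF E], of "col E"])
    show "3 \<le> card ((\<lambda>j. take j x) ` H)"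
      using H(2) \<mu> inj by (simp add: card_image)
    fix u v assume "u \<in> (\<lambda>j. take j x) ` H" "v \<in> (\<lambda>j. take j x) ` H" "u \<noteq> v"
    then show "\<exists>w. (u, w) \<in> E \<and> (w, v) \<in> E"
      using common by blast
  qed (use col[OF E] \<open>finite H\<close> in auto)
  then obtain w where w: "\<And>j. j \<in> H \<Longrightarrow> (take j x, w) \<in> E"
    by blast
  define l where "l = Max H"
  have "H \<noteq> {}"
    using H(2) by auto
  then have l: "l \<in> H" "\<And>j. j \<in> H \<Longrightarrow> j \<le> l"
    unfolding l_def using \<open>finite H\<close> by auto
  then have lm: "l < m" and len: "length (take l x) = l"
    using H(1) x(2) by auto
  show False
  proof (cases "anc (take l x) w")
    case True
    have "2 \<le> card (H - {l})"
      using H(2) \<mu> l(1) by (simp add: card_Diff_singleton)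
    then obtain S where S: "S \<subseteq> H - {l}" "card S = 2"
      by (rule obtain_subset_with_card_n)
    then obtain j k where "S = {j, k}" "j \<noteq> k"
      by (auto simp: card_2_iff)
    then have jk: "j \<in> H" "k \<in> H" "j \<noteq> k" "j < l" "k < l"
      using S(1) l(2)[of j] l(2)[of k] by auto
    have "anc (take i x) (take l x)" if "i \<in> H" "i < l" for i
      using anc_take_balanced[OF x(1), of l i] that H(1) x(2) lm by auto
    moreover have "linked E (desc (take l x)) (take j x) (take k x)"
      using anc_imp_desc[OF True] w family_sym[OF E] jk by (intro linkedI_common[of w]) auto
    moreover have "unlinked (take l x)"
      using x jk lm unfolding balanced_def by auto
    ultimately have "take j x = take k x"
      using unlinkedD[OF _ E] jk by blast
    then show False
      using inj jk by (auto dest: inj_onD)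
  next
    case False
    then have "anc w (take l x)"
      using family_anc[OF E w[OF l(1)]] by blast
    define i where "i = length w"
    have i: "i < l" and wi: "w = take i x" and att: "attached i (take l x)"
      using \<open>anc w (take l x)\<close> anc_length[OF \<open>anc w (take l x)\<close>] len
      unfolding anc_def i_def by (auto simp: min_def)
    \<comment> \<open>The deepest vertex is still adjacent to \<open>w\<close>, so \<open>w\<close>
      was not yet overused just before it.\<close>
    have "\<not> overused x (l - 1) i"
      using att attached_balanced[OF x(1), of l i] lm x(2) by simp
    then have usage: "usage E x (l - 1) i < 2 * \<mu>"
      using E unfolding overused_def by auto
    have up: "(take j x, take i x) \<in> E" if "j \<in> H" for j
      using w[OF that] wi by simp
    have "i \<notin> H"
      using up col[OF E] by blast
    have "card {j \<in> H. j < i} \<le> 1"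
      unfolding One_nat_def
      using balanced_unique_parent[OF x(1) E, of i] up i lm x(2) \<open>finite H\<close>
      by (subst card_le_Suc0_iff_eq) auto
    \<comment> \<open>At most one element above \<open>w\<close>, fewer than
      \<open>2 * \<mu>\<close> between \<open>w\<close> and depth \<open>l - 1\<close>, and
      \<open>l\<close> itself: at most \<open>2 * \<mu> + 1\<close> in all.\<close>
    moreover have "H \<subseteq> insert l ({j \<in> H. j < i} \<union> {k. i < k \<and> k \<le> l - 1 \<and> (take i x, take k x) \<in> E})"
      (is "_ \<subseteq> insert l (?S \<union> ?T)")
    proof
      fix h assume h: "h \<in> H"
      then have "h < i \<or> h = l \<or> (i < h \<and> h \<le> l - 1)"
        using l(2)[OF h] \<open>i \<notin> H\<close> by (cases h i rule: linorder_cases) auto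
      then show "h \<in> insert l (?S \<union> ?T)"
        using h family_sym[OF E up[OF h]] by blast
    qed
    then have "card H \<le> card (insert l (?S \<union> ?T))"
      using \<open>finite H\<close> by (intro card_mono) auto
    moreover have "card (insert l (?S \<union> ?T)) \<le> Suc (card (?S \<union> ?T))"
      by (simp add: card_insert_if)
    moreover have "card (?S \<union> ?T) \<le> card ?S + card ?T"
      by (rule card_Un_le)
    ultimately show False
      using usage H(2) unfolding usage_def by linarith
  qed
qed

text \<open>By \<open>colH\<close> and \<open>common\<close>, walks in a tree between distinct
  vertices of the clique given by \<open>H\<close> have even length other than 2, hence at least 4.
  The pair consists of a new child \<open>c\<close> of the deepest of them and a suitable neighbour
  of \<open>c\<close> in the clique.\<close>

lemma far_adjacent_pair:
  assumes x: "balanced x" "length x = m" "x \<in> nodes m N"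
    and H: "H \<subseteq> {j. j < m \<and> \<not> overused x m j}" "\<mu> < card H"
    and colH: "\<And>E j k. \<lbrakk>E \<in> \<E>; j \<in> H; k \<in> H\<rbrakk> \<Longrightarrow> col E (take j x) = col E (take k x)"
    and common: "\<And>E j k w. \<lbrakk>E \<in> \<E>; j \<in> H; k \<in> H; (take j x, w) \<in> E; (w, take k x) \<in> E\<rbrakk> \<Longrightarrow> j = k"
  shows "\<exists>(u, v) \<in> node_arcs m N. \<forall>E \<in> \<E>. \<forall>n \<le> 4. (u, v) \<notin> E ^^ n"
proof -
  have "finite H"
    using H(1) by (rule finite_subset) simp
  have "H \<noteq> {}"
    using H(2) by auto
  define l where "l = Max H"
  have l: "l \<in> H" "\<And>j. j \<in> H \<Longrightarrow> j \<le> l"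
    unfolding l_def using \<open>finite H\<close> \<open>H \<noteq> {}\<close> by auto
  then have lm: "l < m" and len: "length (take l x) = l"
    using H(1) x(2) by auto
  \<comment> \<open>The parent at depth \<open>l\<close> stays adjacent to the child; banning the
    other depths outside \<open>H\<close> leaves exactly \<open>H\<close>.\<close>
  define B where "B = {..<l} - H"
  obtain k where k: "k < N" "unlinked (take l x @ [(B, k)])"
    using exists_unlinked_child[of "take l x" B] len lm by auto
  define c where "c = take l x @ [(B, k)]"
  define Y where "Y = (\<lambda>j. take j x) ` H"
  have lenc: "length c = Suc l"
    unfolding c_def using len by simp
  have c: "c \<in> nodes m N"
    using take_in_nodes[OF x(3), of l] k(1) lm len unfolding c_def nodes_def B_def by auto
  have take_c: "take j c = take j x" if "j \<le> l" for j
    using that len unfolding c_def by (simp add: min_def)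
  have att: "attached j c \<longleftrightarrow> j \<in> H" for j
  proof (cases "j < l")
    case True
    have "attached j (take l x)" if "j \<in> H"
      using anc_take_balanced[OF x(1), of l j] that H(1) x(2) lm True unfolding anc_def
      by (auto simp: min_def)
    then show ?thesis
      using True len unfolding c_def B_def by (auto simp: attached_append)
  next
    case False
    have "attached l c"
      unfolding attached_def c_def using len by simp
    moreover have "attached j c \<Longrightarrow> j \<le> l"
      unfolding attached_def using lenc by simp
    ultimately show ?thesis
      using l False by (metis le_neq_implies_less)
  qed
  have ancY: "anc u c \<longleftrightarrow> u \<in> Y" for u
  proof
    assume "anc u c"
    then have "length u \<in> H" "take (length u) c = u"
      using att unfolding anc_def by auto
    then show "u \<in> Y"
      unfolding Y_def using take_c l(2) by force
  next
    assume "u \<in> Y"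
    then obtain j where j: "j \<in> H" "u = take j x"
      unfolding Y_def by blast
    then have "length u = j"
      using H(1) x(2) by auto
    then show "anc u c"
      using j att take_c l(2) unfolding anc_def by simp
  qed
  let ?D = "desc c"
  \<comment> \<open>The tree reaches \<open>y\<close> from \<open>c\<close> without leaving the
    subtree of \<open>c\<close> before the last step.\<close>
  define hit where "hit E y \<longleftrightarrow> (\<exists>z \<in> ?D. (c, z) \<in> (E \<inter> ?D \<times> ?D)\<^sup>* \<and> (z, y) \<in> E)" for E y
  have hit_unique: "y = y'" if "E \<in> \<E>" "y \<in> Y" "y' \<in> Y" and hits: "hit E y" "hit E y'" for E y y'
  proof -
    obtain z z' where z: "z \<in> ?D" "(c, z) \<in> (E \<inter> ?D \<times> ?D)\<^sup>*" "(z, y) \<in> E"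
      "z' \<in> ?D" "(c, z') \<in> (E \<inter> ?D \<times> ?D)\<^sup>*" "(z', y') \<in> E"
      using hits unfolding hit_def by blast
    have "sym ((E \<inter> ?D \<times> ?D)\<^sup>*)"
      using family_sym[OF \<open>E \<in> \<E>\<close>] by (intro sym_rtrancl) (auto simp: sym_def)
    then have "(z, z') \<in> (E \<inter> ?D \<times> ?D)\<^sup>*"
      using z(2,5) by (meson rtrancl_trans symD)
    then have "linked E ?D y y'"
      unfolding linked_def using z family_sym[OF \<open>E \<in> \<E>\<close>] by blast
    then show ?thesis
      using unlinkedD[OF k(2) \<open>E \<in> \<E>\<close>] ancY that unfolding c_def by blast
  qed
  \<comment> \<open>Each tree hits at most one vertex of \<open>Y\<close>, and \<open>Y\<close> has
    more elements than there are trees.\<close>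
  have "\<exists>y \<in> Y. \<forall>E \<in> \<E>. \<not> hit E y"
  proof (rule ccontr)
    assume "\<not> ?thesis"
    then obtain f where f: "\<And>y. y \<in> Y \<Longrightarrow> f y \<in> \<E> \<and> hit (f y) y"
      by metis
    then have "inj_on f Y"
      using hit_unique by (intro inj_onI) metis
    then have "card Y \<le> card \<E>"
      using f family(1) by (intro card_inj_on_le[of f]) auto
    moreover have "card Y = card H"
      unfolding Y_def using H(1) x(2)
      by (intro card_image inj_onI) (metis (no_types, lifting) length_take less_imp_le_nat mem_Collect_eq min.absorb2 subsetD)
    ultimately show False
      using H(2) family(2) by simp
  qed
  then obtain y where y: "y \<in> Y" "\<And>E. E \<in> \<E> \<Longrightarrow> \<not> hit E y"
    by blast
  have "(c, y) \<in> node_arcs m N"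
    using c y(1) ancY take_in_nodes[OF x(3)] unfolding node_arcs_def Y_def by auto
  moreover have "(c, y) \<notin> E ^^ n" if E: "E \<in> \<E>" and n: "n \<le> 4" for E n
  proof
    assume walk: "(c, y) \<in> E ^^ n"
    have "c \<in> ?D" "y \<notin> ?D"
      using anc_length[of y c] ancY y(1) desc_length[of y c] unfolding desc_def by auto
    from relpow_exit[OF walk this] obtain z p i where zp: "z \<in> ?D" "(c, z) \<in> (E \<inter> ?D \<times> ?D)\<^sup>*"
      "(z, p) \<in> E" "p \<notin> ?D" "(p, y) \<in> E ^^ i" "i < n"
      by blast
    \<comment> \<open>The exit arc leads upward out of the subtree, so by \<open>anc_desc\<close> it
      ends in an attachment vertex of \<open>c\<close>.\<close>
    have "\<not> anc z p"
      using desc_trans[of z c p] anc_imp_desc[of z p] desc_length[of z c] zp(1,4) by blast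
    then have "anc p z"
      using family_anc[OF E zp(3)] by blast
    have "length p < length c"
    proof (rule ccontr)
      assume "\<not> ?thesis"
      then have "take (length c) p = take (length c) z"
        using \<open>anc p z\<close> unfolding anc_def by (metis min.absorb1 not_less take_take)
      then show False
        using zp(1,4) unfolding desc_def by simp
    qed
    then have "p \<in> Y"
      using anc_desc[OF \<open>anc p z\<close> zp(1)] ancY by blast
    have "p \<noteq> y"
      using zp y(2)[OF E] unfolding hit_def by blast
    obtain j j' where j: "j \<in> H" "j' \<in> H" "p = take j x" "y = take j' x"
      using \<open>p \<in> Y\<close> y(1) unfolding Y_def by (elim imageE)
    then have "col E p = col E y"
      using colH[OF E j(1,2)] by simp
    then have "even i"
      using bipartite_relpow[of E "col E" p y i] col[OF E] zp(5) by simp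
    moreover have "i \<noteq> 0"
      using zp(5) \<open>p \<noteq> y\<close> by (intro notI) simp
    \<comment> \<open>Leaving the subtree used a step, so \<open>i < 4\<close>; with
      \<open>i\<close> even and nonzero only 2 is left, which \<open>common\<close>
      excludes.\<close>
    ultimately have "i = 2"
      using zp(6) n by presburger
    then obtain w where "(p, w) \<in> E" "(w, y) \<in> E"
      using zp(5) by (auto simp: numeral_2_eq_2)
    then show False
      using common[OF E j(1,2), of w] j(3,4) \<open>p \<noteq> y\<close> by simp
  qed
  ultimately show ?thesis
    by blast
qed

end

section \<open>Choice of the parameters\<close>

theorem exists_far_adjacent_pair:
  assumes "0 < \<mu>"
  shows "\<exists>m N. \<forall>\<E>. finite \<E> \<longrightarrow> card \<E> \<le> \<mu> \<longrightarrow>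
     (\<forall>E \<in> \<E>. forest_rel E \<and> E \<subseteq> node_arcs m N \<and> (\<exists>col :: node \<Rightarrow> bool. \<forall>(u, v) \<in> E. col u \<noteq> col v)) \<longrightarrow>
     (\<exists>(u, v) \<in> node_arcs m N. \<forall>E \<in> \<E>. \<forall>n \<le> 4. (u, v) \<notin> E ^^ n)"
proof -
  \<comment> \<open>The clique size forbidden by \<open>no_common_neighbour_clique\<close>; it is
    also at least 3, for the colours, and exceeds \<open>\<mu>\<close>, for
    \<open>far_adjacent_pair\<close>.\<close>
  define q where "q = 2 * \<mu> + 2"
  obtain M where M: "\<forall>(V :: nat set) \<P>. finite V \<and> M \<le> card V \<and> finite \<P> \<and> card \<P> \<le> 2 * \<mu> \<and>
     (\<forall>P \<in> \<P>. \<forall>x y. P x y \<longrightarrow> P y x) \<and>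
     (\<forall>P \<in> \<P>. \<forall>H \<subseteq> V. card H = q \<longrightarrow> (\<exists>x \<in> H. \<exists>y \<in> H. x \<noteq> y \<and> \<not> P x y)) \<longrightarrow>
     (\<exists>H \<subseteq> V. card H = q \<and> (\<forall>P \<in> \<P>. \<forall>x \<in> H. \<forall>y \<in> H. x \<noteq> y \<longrightarrow> \<not> P x y))"
    using ramsey_cocliques ..
  \<comment> \<open>At least half of the depths are not overused, which leaves the \<open>M\<close>
    needed for Ramsey.\<close>
  define m where "m = 2 * M"
  define N where "N = Suc (\<mu> * m\<^sup>2)"
  show ?thesis
  proof (rule exI[of _ m], rule exI[of _ N], intro allI impI)
    fix \<E> :: "node rel set"
    assume \<E>: "finite \<E>" "card \<E> \<le> \<mu>"
      and all: "\<forall>E \<in> \<E>. forest_rel E \<and> E \<subseteq> node_arcs m N \<and> (\<exists>col :: node \<Rightarrow> bool. \<forall>(u, v) \<in> E. col u \<noteq> col v)"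
    then obtain col :: "node rel \<Rightarrow> node \<Rightarrow> bool"
      where "\<And>E. E \<in> \<E> \<Longrightarrow> \<forall>(u, v) \<in> E. col E u \<noteq> col E v"
      by metis
    then have col: "col E u \<noteq> col E v" if "E \<in> \<E>" "(u, v) \<in> E" for E u v
      using that by blast
    interpret tree_family m N \<mu> \<E> col
    proof
      show "\<mu> * m\<^sup>2 < N"
        unfolding N_def by simp
      show "forest_rel E" "E \<subseteq> node_arcs m N" if "E \<in> \<E>" for E
        using all that by simp_all
    qed (fact assms \<E> col)+
    obtain x where x: "x \<in> nodes m N" "length x = m" "balanced x"
      using exists_balanced[of m] by auto
    define A where "A = {j. j < m \<and> \<not> overused x m j}"
    have "A = {..<m} - {j. j < m \<and> overused x m j}"
      unfolding A_def by auto
    then have "card A = m - card {j. j < m \<and> overused x m j}"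
      using card_Diff_subset[of "{j. j < m \<and> overused x m j}" "{..<m}"] by auto
    then have cardA: "M \<le> card A"
      using card_overused[OF x(3,2)] unfolding m_def by linarith
    \<comment> \<open>Two relations per tree: \<open>P\<close> marks different colours,
      \<open>P'\<close> a common neighbour. This is the source of the bound
      \<open>2 * \<mu>\<close>.\<close>
    define P where "P E j k \<longleftrightarrow> col E (take j x) \<noteq> col E (take k x)" for E j k
    define P' where "P' E j k \<longleftrightarrow> (\<exists>w. (take j x, w) \<in> E \<and> (w, take k x) \<in> E)" for E j k
    let ?\<P> = "P ` \<E> \<union> P' ` \<E>"
    have "\<exists>H \<subseteq> A. card H = q \<and> (\<forall>P \<in> ?\<P>. \<forall>x \<in> H. \<forall>y \<in> H. x \<noteq> y \<longrightarrow> \<not> P x y)"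
    proof (rule M[THEN spec, THEN spec, THEN mp], intro conjI)
      show "finite A" "M \<le> card A" "finite ?\<P>"
        using cardA \<E> unfolding A_def by simp_all
      have "card ?\<P> \<le> card (P ` \<E>) + card (P' ` \<E>)"
        by (rule card_Un_le)
      also have "\<dots> \<le> 2 * \<mu>"
        using card_image_le[OF \<E>(1), of P] card_image_le[OF \<E>(1), of P'] \<E>(2) by linarith
      finally show "card ?\<P> \<le> 2 * \<mu>" .
      show "\<forall>P \<in> ?\<P>. \<forall>x y. P x y \<longrightarrow> P y x"
        unfolding P_def P'_def using family_sym by blast
      show "\<forall>P \<in> ?\<P>. \<forall>H \<subseteq> A. card H = q \<longrightarrow> (\<exists>x \<in> H. \<exists>y \<in> H. x \<noteq> y \<and> \<not> P x y)"
      proof (intro ballI allI impI)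
        fix R H assume R: "R \<in> ?\<P>" and H: "H \<subseteq> A" "card H = q"
        then consider E where "E \<in> \<E>" "R = P E" | E where "E \<in> \<E>" "R = P' E"
          by blast
        then show "\<exists>x \<in> H. \<exists>y \<in> H. x \<noteq> y \<and> \<not> R x y"
        proof cases
          case 1
          have "3 \<le> card H"
            using H assms unfolding q_def by simp
          then obtain S where S: "S \<subseteq> H" "card S = 3"
            by (meson obtain_subset_with_card_n)
          then obtain a b c where abc: "a \<in> H" "b \<in> H" "c \<in> H" "a \<noteq> b" "b \<noteq> c" "a \<noteq> c"
            by (auto simp: card_3_iff)
          have "\<not> P E a b \<or> \<not> P E b c \<or> \<not> P E a c"
            unfolding P_def by blast
          with abc 1 show ?thesis by blast
        next
          case 2
          have "2 * \<mu> + 2 \<le> card H"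
            using H unfolding q_def by simp
          with 2 show ?thesis
            using no_common_neighbour_clique[OF x(3,2) 2(1) H(1)[unfolded A_def]] unfolding P'_def by blast
        qed
      qed
    qed
    then obtain H where H: "H \<subseteq> A" "card H = q"
      and free: "\<forall>P \<in> ?\<P>. \<forall>x \<in> H. \<forall>y \<in> H. x \<noteq> y \<longrightarrow> \<not> P x y"
      by (elim exE conjE)
    show "\<exists>(u, v) \<in> node_arcs m N. \<forall>E \<in> \<E>. \<forall>n \<le> 4. (u, v) \<notin> E ^^ n"
    proof (rule far_adjacent_pair[OF x(3,2,1) H(1)[unfolded A_def]])
      show "\<mu> < card H"
        using H(2) unfolding q_def by linarith
    next
      fix E j k assume "E \<in> \<E>" "j \<in> H" "k \<in> H"
      then have "j = k \<or> \<not> P E j k"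
        using free[THEN bspec, of "P E"] by auto
      then show "col E (take j x) = col E (take k x)"
        unfolding P_def by auto
    next
      fix E j k w assume E: "E \<in> \<E>" "j \<in> H" "k \<in> H" and w: "(take j x, w) \<in> E" "(w, take k x) \<in> E"
      then have "P' E j k"
        unfolding P'_def by blast
      then show "j = k"
        using free[THEN bspec, of "P' E"] E by auto
    qed
  qed
qed

section \<open>Walks, trees and chordality\<close>

lemma pair_graphI_rel:
  assumes "finite V" "A \<subseteq> V \<times> V" "sym A" "irrefl A"
  shows "pair_graph \<lparr>pverts = V, parcs = A\<rparr>"
proof
  show "finite (parcs \<lparr>pverts = V, parcs = A\<rparr>)"
    using assms(1,2) by (auto intro: finite_subset)
qed (use assms in \<open>auto simp: symmetric_def irrefl_def\<close>)

lemma parcs_sym: "pair_graph G \<Longrightarrow> sym (parcs G)"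
  using pair_sym_digraph.pair_sym_arcs[of G]
  by (simp add: pair_graph.axioms(2) pair_pseudo_graph.axioms(2) symmetric_def)

lemma parcs_irrefl: "pair_graph G \<Longrightarrow> irrefl (parcs G)"
  using pair_loopfree_digraph.pair_no_loops[of G]
  by (force simp: irrefl_def pair_graph.axioms(1) pair_digraph.axioms(2))

lemma pair_graph_wf: "pair_graph G \<Longrightarrow> pair_wf_digraph G"
  by (simp add: pair_graph.axioms(1) pair_digraph.axioms(1) pair_fin_digraph.axioms(1))

lemma parcs_subset: "pair_graph G \<Longrightarrow> parcs G \<subseteq> pverts G \<times> pverts G"
  using pair_graph_wf[of G] pair_wf_digraph.in_arcsD1 pair_wf_digraph.in_arcsD2 by fastforce

lemma connected_graph_iff:
  "connected_graph G \<longleftrightarrow> pair_graph G \<and> pverts G \<noteq> {} \<and>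
     (\<forall>u \<in> pverts G. \<forall>v \<in> pverts G. (u, v) \<in> (parcs G)\<^sup>*)"
proof (cases "pair_graph G")
  case True
  then interpret pair_graph G .
  have "connected (with_proj G) \<longleftrightarrow> pverts G \<noteq> {} \<and>
      (\<forall>u \<in> pverts G. \<forall>v \<in> pverts G. u \<rightarrow>\<^sup>*\<^bsub>with_proj G\<^esub> v)"
    using reachable_mk_symmetric_eq[OF pair_sym_arcs]
    unfolding connected_def strongly_connected_def by simp
  then show ?thesis
    using True reachable_conv' unfolding connected_graph_def by auto
qed (simp add: connected_graph_def)

lemma pcas_append: "pcas u (p @ q) w \<longleftrightarrow> (\<exists>v. pcas u p v \<and> pcas v q w)"
  by (induction p arbitrary: u) auto

lemma pcas_relpow: "\<lbrakk>pcas u p v; set p \<subseteq> R\<rbrakk> \<Longrightarrow> (u, v) \<in> R ^^ length p"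
proof (induction p arbitrary: u)
  case (Cons e p)
  then have "(u, snd e) \<in> R" "(snd e, v) \<in> R ^^ length p"
    by (cases e, auto)+
  then show ?case
    by (metis length_Cons relpow_Suc_I2)
qed simp

lemma pcas_verts: "pcas u p v \<Longrightarrow> pawalk_verts u p = u # map snd p"
proof (induction p arbitrary: u)
  case (Cons e p)
  then show ?case
    by (cases e) auto
qed simp

lemma rtrancl_map:
  assumes "(a, b) \<in> R\<^sup>*" "\<And>x y. (x, y) \<in> R \<Longrightarrow> (f x, f y) \<in> S"
  shows "(f a, f b) \<in> S\<^sup>*"
  using assms(1) by induction (auto intro: rtrancl_into_rtrancl assms(2))

text \<open>Connectedness makes the \<open>LEAST\<close> in \<open>graph_dist\<close>
  attained.\<close>

lemma graph_dist_relpow: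
  assumes "connected_graph T" "u \<in> pverts T" "v \<in> pverts T"
  shows "(u, v) \<in> parcs T ^^ graph_dist T u v"
proof -
  interpret pair_graph T
    using assms(1) by (simp add: connected_graph_def)
  have "u \<rightarrow>\<^sup>*\<^bsub>with_proj T\<^esub> v"
    using assms reachable_conv' by (simp add: connected_graph_iff)
  then have "\<exists>n p. apath u p v \<and> length p = n"
    using reachable_apath by blast
  then have "\<exists>p. apath u p v \<and> length p = graph_dist T u v"
    unfolding graph_dist_def by (rule LeastI_ex)
  then show ?thesis
    using pcas_relpow unfolding apath_def awalk_def by metis
qed

lemma graph_dist_adjacent:
  assumes "pair_graph G" "(u, v) \<in> parcs G"
  shows "graph_dist G u v \<le> 1"
proof -
  interpret pair_graph G by fact
  have "apath u [(u, v)] v"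
    using assms parcs_subset parcs_irrefl unfolding apath_def awalk_def irrefl_def by auto
  then show ?thesis
    unfolding graph_dist_def by (intro Least_le) auto
qed

text \<open>A connection of \<open>a\<close> and \<open>b\<close> off \<open>y\<close> contains a
  path in the graph without \<open>y\<close>; closing it by the two arcs at \<open>y\<close> gives a
  cycle, of length at least 3 because \<open>a \<noteq> b\<close>.\<close>

lemma undirected_tree_forest_rel:
  assumes "undirected_tree T"
  shows "forest_rel (parcs T)"
proof -
  have T: "pair_graph T" and acyclic: "\<And>p. \<not> undirected_cycle T p"
    using assms unfolding undirected_tree_def connected_graph_def by auto
  interpret pair_graph T by fact
  show ?thesis
    unfolding forest_rel_def
  proof (intro conjI allI impI notI)
    fix y a b
    let ?R = "parcs T \<inter> (- {y}) \<times> (- {y})"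
    assume ya: "(y, a) \<in> parcs T" and yb: "(y, b) \<in> parcs T" and "a \<noteq> b" and ab: "(a, b) \<in> ?R\<^sup>*"
    define T' where "T' = \<lparr>pverts = pverts T - {y}, parcs = ?R\<rparr>"
    interpret T': pair_wf_digraph T'
      using parcs_subset[OF T] by unfold_locales (auto simp: T'_def)
    have "y \<in> pverts T" "a \<in> pverts T'" "a \<noteq> y"
      using ya parcs_subset[OF T] parcs_irrefl[OF T] unfolding T'_def irrefl_def by auto
    then have "a \<rightarrow>\<^sup>*\<^bsub>with_proj T'\<^esub> b"
      using ab T'.reachable_conv' by (simp add: T'_def)
    then obtain q where "T'.apath a q b"
      using T'.reachable_apath by blast
    then have walk: "pcas a q b" and q: "set q \<subseteq> ?R" and dist: "distinct (pawalk_verts a q)"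
      unfolding T'.apath_def T'.awalk_def by (auto simp: T'_def)
    then have avoid: "y \<notin> set (pawalk_verts a q)"
      using \<open>a \<noteq> y\<close> pcas_verts[OF walk] by auto
    let ?c = "(y, a) # q @ [(b, y)]"
    have verts: "pawalk_verts a (q @ [(b, y)]) = pawalk_verts a q @ [y]"
      using walk by (induction q arbitrary: a) auto
    have "pcas y ?c y"
      unfolding pcas.simps pcas_append using walk by auto
    moreover have "(b, y) \<in> parcs T"
      using yb parcs_sym[OF T] by (meson symD)
    ultimately have "awalk y ?c y"
      using \<open>y \<in> pverts T\<close> ya q unfolding awalk_def by simp
    moreover have "distinct (tl (pawalk_verts y ?c))"
      using dist avoid verts by simp
    moreover have "3 \<le> length ?c"
      using walk \<open>a \<noteq> b\<close> by (cases q) auto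
    ultimately have "undirected_cycle T ?c"
      unfolding undirected_cycle_def cycle_def by auto
    then show False
      using acyclic by blast
  qed (rule parcs_sym[OF T])
qed

section \<open>Cycles and elimination orders\<close>

text \<open>A periodic enumeration of the cycle by all natural numbers spares the wrap-around cases
  later.\<close>

lemma undirected_cycle_indexing:
  assumes "undirected_cycle C p"
  shows "\<exists>s :: nat \<Rightarrow> 'a. set p = {(s k, s (Suc k)) | k. True} \<and>
    (\<forall>k l. s k = s l \<longleftrightarrow> k mod length p = l mod length p)"
proof -
  interpret pair_pre_digraph C .
  let ?n = "length p"
  obtain u where u: "pcas u p u" "distinct (tl (pawalk_verts u p))" "3 \<le> ?n"
    using assms unfolding undirected_cycle_def cycle_def awalk_def by auto
  define s where "s k = fst (p ! (k mod ?n))" for k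
  have next_arc: "snd (q ! k) = (if Suc k < length q then fst (q ! Suc k) else v)"
    if "pcas w q v" "k < length q" for w q k and v :: 'a
    using that
  proof (induction q arbitrary: w k)
    case (Cons e q)
    then show ?case
      by (cases k; cases q) auto
  qed simp
  have "fst (p ! 0) = u"
    using u by (cases p) auto
  then have step: "snd (p ! (k mod ?n)) = s (Suc k)" for k
  proof -
    have "k mod ?n < ?n"
      using u(3) by (intro mod_less_divisor) linarith
    then show ?thesis
      using next_arc[OF u(1), of "k mod ?n"] \<open>fst (p ! 0) = u\<close> unfolding s_def mod_Suc
      by (cases "Suc (k mod ?n) = ?n") simp_all
  qed
  have arc: "p ! (k mod ?n) = (s k, s (Suc k))" for k
    using step[of k] unfolding s_def by (metis prod.collapse)
  have "set p = {(s k, s (Suc k)) | k. True}"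
  proof -
    have "set p = {p ! (k mod ?n) | k. True}"
    proof (intro equalityI subsetI)
      fix e assume "e \<in> set p"
      then obtain k where "k < ?n" "p ! k = e"
        by (auto simp: in_set_conv_nth)
      then have "e = p ! (k mod ?n)"
        by simp
      then show "e \<in> {p ! (k mod ?n) | k. True}"
        by blast
    next
      fix e assume "e \<in> {p ! (k mod ?n) | k. True}"
      moreover have "k mod ?n < ?n" for k
        using u(3) by (intro mod_less_divisor) linarith
      ultimately show "e \<in> set p"
        by auto
    qed
    then show ?thesis
      unfolding arc .
  qed
  moreover have "s k = s l \<longleftrightarrow> k mod ?n = l mod ?n" for k l
  proof
    assume eq: "s k = s l"
    have pos: "0 < ?n"
      using u(3) by linarith
    have "distinct (map snd p)"
      using u(2) pcas_verts[OF u(1)] by simp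
    \<comment> \<open>Distinctness is known for the heads of arcs, so \<open>s k\<close> is read as
      the head of the preceding arc; adding \<open>?n\<close> avoids truncated subtraction.\<close>
    have snd: "snd (p ! ((k + ?n - 1) mod ?n)) = s k" for k
      using step[of "k + ?n - 1"] pos unfolding s_def by simp
    then have "map snd p ! ((k + ?n - 1) mod ?n) = map snd p ! ((l + ?n - 1) mod ?n)"
      using eq pos by simp
    then have "(k + ?n - 1) mod ?n = (l + ?n - 1) mod ?n"
      using nth_eq_iff_index_eq[OF \<open>distinct (map snd p)\<close>] pos by simp
    then have "Suc (k + ?n - 1) mod ?n = Suc (l + ?n - 1) mod ?n"
      by (metis mod_Suc_eq)
    then show "k mod ?n = l mod ?n"
      using pos by simp
  qed (simp add: s_def)
  ultimately show ?thesis
    by blast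
qed

text \<open>The two cycle neighbours of a vertex of maximal rank are adjacent by
  \<open>elim\<close>, which is a chord. Ties in rank are allowed.\<close>

lemma chordalI_rank:
  fixes rank :: "'a \<Rightarrow> nat"
  assumes elim: "\<And>v a b. \<lbrakk>(a, v) \<in> parcs G; (v, b) \<in> parcs G; a \<noteq> b; rank a \<le> rank v; rank b \<le> rank v\<rbrakk>
    \<Longrightarrow> (a, b) \<in> parcs G"
  shows "chordal G"
  unfolding chordal_def
proof (rule notI, elim exE conjE)
  fix C n
  assume ind: "induced_subgraph (with_proj C) (with_proj G)" and cyc: "cycle_graph n C" and "n > 3"
  then obtain p where p: "undirected_cycle C p" "length p = n" "pverts C = fst ` set p"
    "parcs C = set p \<union> (set p)\<inverse>"
    unfolding cycle_graph_def by blast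
  obtain s where s: "set p = {(s k, s (Suc k)) | k. True}" "\<And>k l. s k = s l \<longleftrightarrow> k mod n = l mod n"
    using undirected_cycle_indexing[OF p(1)] p(2) by blast
  have parcsC: "parcs C = {e \<in> parcs G. fst e \<in> pverts C \<and> snd e \<in> pverts C}"
    using ind unfolding induced_subgraph_def by simp
  have vertsC: "s k \<in> pverts C" for k
    unfolding p(3) s(1) by force
  let ?S = "(\<lambda>k. rank (s k)) ` {..<n}"
  have "Max ?S \<in> ?S"
    using \<open>n > 3\<close> by (intro Max_in) auto
  then obtain i where "i < n" "Max ?S = rank (s i)"
    by auto
  then have i: "rank (s k) \<le> rank (s i)" if "k < n" for k
    using Max_ge[of ?S "rank (s k)"] that by auto
  have top: "rank (s k) \<le> rank (s i)" for k
    using i[of "k mod n"] s(2)[of k "k mod n"] \<open>n > 3\<close> by simp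
  define k where "k = i + n - 1"
  have ki: "s (Suc k) = s i"
    using s(2) \<open>n > 3\<close> unfolding k_def by simp
  have mod_neq: "s (k + d) \<noteq> s k" if "0 < d" "d < n" for k d
    using that s(2)[of "k + d" k] mod_eq_dvd_iff_nat[of k "k + d" n] by (auto dest: dvd_imp_le)
  have "(s k, s (Suc k)) \<in> parcs G" "(s (Suc k), s (Suc (Suc k))) \<in> parcs G"
    using s(1) parcsC p(4) by blast+
  then have "(s k, s (Suc (Suc k))) \<in> parcs G"
    using elim[of "s k" "s (Suc k)" "s (Suc (Suc k))"] top ki mod_neq[of 2 k] \<open>n > 3\<close> by simp
  then have "(s k, s (Suc (Suc k))) \<in> set p \<union> (set p)\<inverse>"
    using vertsC parcsC p(4) by auto
  \<comment> \<open>The cycle is induced, so the chord is a cycle arc in one of the two directions;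
    this identifies vertices whose indices differ by 1 or by 3, impossible for
    \<open>n > 3\<close>.\<close>
  then consider l where "s k = s l" "s (Suc (Suc k)) = s (Suc l)" | l where "s (Suc (Suc k)) = s l" "s k = s (Suc l)"
    using s(1) by auto
  then show False
  proof cases
    case 1
    then have "s (Suc l) = s (Suc k)"
      using s(2) by (metis mod_Suc_eq)
    with 1 show False
      using mod_neq[of 1 "Suc k"] \<open>n > 3\<close> by simp
  next
    case 2
    then have "s (Suc (Suc (Suc k))) = s (Suc l)"
      using s(2) by (metis mod_Suc_eq)
    with 2 show False
      using mod_neq[of 3 k] \<open>n > 3\<close> by (simp add: numeral_3_eq_3)
  qed
qed

section \<open>The graph on natural numbers\<close>

lemma node_arcs_sym: "sym (node_arcs m N)"
  unfolding node_arcs_def sym_def by blast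

lemma node_arcs_irrefl: "(u, u) \<notin> node_arcs m N"
  unfolding node_arcs_def using anc_length by blast

lemma node_arcs_connected:
  assumes "v \<in> nodes m N"
  shows "([], v) \<in> (node_arcs m N)\<^sup>*"
  using assms
proof (induction v rule: rev_induct)
  case (snoc b v)
  then have "v \<in> nodes m N"
    unfolding nodes_def by auto
  with snoc have "([], v) \<in> (node_arcs m N)\<^sup>*" "(v, v @ [b]) \<in> node_arcs m N"
    using anc_parent unfolding node_arcs_def by auto
  then show ?case
    by (rule rtrancl_into_rtrancl)
qed simp

text \<open>Neighbours that are not deeper are attachment vertices, so \<open>anc_clique\<close>
  applies: depth is an elimination order.\<close>

lemma node_arcs_rank_elim:
  assumes "(a, v) \<in> node_arcs m N" "(v, b) \<in> node_arcs m N" "a \<noteq> b"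
    "length a \<le> length v" "length b \<le> length v"
  shows "(a, b) \<in> node_arcs m N"
  using assms anc_length[of v a] anc_length[of v b] anc_clique[of a v b]
  unfolding node_arcs_def by auto

definition node_graph :: "(node \<Rightarrow> 'a) \<Rightarrow> nat \<Rightarrow> nat \<Rightarrow> 'a pair_pre_digraph" where
  "node_graph f m N = \<lparr>pverts = f ` nodes m N, parcs = map_prod f f ` node_arcs m N\<rparr>"

context
  fixes f :: "node \<Rightarrow> 'a" and m N :: nat
  assumes inj: "inj_on f (nodes m N)"
begin

lemma node_graph_parcs:
  "\<lbrakk>u \<in> nodes m N; v \<in> nodes m N\<rbrakk> \<Longrightarrow>
    (f u, f v) \<in> parcs (node_graph f m N) \<longleftrightarrow> (u, v) \<in> node_arcs m N"
  unfolding node_graph_def by (auto simp: node_arcs_def dest!: inj_onD[OF inj])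

lemma pair_graph_node_graph: "pair_graph (node_graph f m N)"
  unfolding node_graph_def
proof (rule pair_graphI_rel)
  show "finite (f ` nodes m N)"
    using finite_nodes by blast
  show "map_prod f f ` node_arcs m N \<subseteq> f ` nodes m N \<times> f ` nodes m N"
    unfolding node_arcs_def by auto
  show "sym (map_prod f f ` node_arcs m N)"
    using node_arcs_sym by (force simp: sym_def)
  show "irrefl (map_prod f f ` node_arcs m N)"
    using node_arcs_irrefl inj_onD[OF inj] by (fastforce simp: irrefl_def node_arcs_def)
qed

lemma connected_node_graph: "connected_graph (node_graph f m N)"
proof -
  have from_root: "(f [], f v) \<in> (parcs (node_graph f m N))\<^sup>*" if "v \<in> nodes m N" for v
    using node_arcs_connected[OF that] by (rule rtrancl_map) (force simp: node_graph_def)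
  have "sym ((parcs (node_graph f m N))\<^sup>*)"
    using parcs_sym[OF pair_graph_node_graph] by (rule sym_rtrancl)
  then have "(f u, f v) \<in> (parcs (node_graph f m N))\<^sup>*" if "u \<in> nodes m N" "v \<in> nodes m N" for u v
    using from_root that by (meson rtrancl_trans symD)
  moreover have "[] \<in> nodes m N"
    unfolding nodes_def by simp
  ultimately show ?thesis
    using pair_graph_node_graph unfolding connected_graph_iff by (auto simp: node_graph_def)
qed

lemma chordal_node_graph: "chordal (node_graph f m N)"
proof (rule chordalI_rank[where rank = "\<lambda>v. length (inv_into (nodes m N) f v)"])
  fix v a b
  assume arcs: "(a, v) \<in> parcs (node_graph f m N)" "(v, b) \<in> parcs (node_graph f m N)" "a \<noteq> b"
    and rank: "length (inv_into (nodes m N) f a) \<le> length (inv_into (nodes m N) f v)"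
      "length (inv_into (nodes m N) f b) \<le> length (inv_into (nodes m N) f v)"
  obtain a' v' b' where "a = f a'" "v = f v'" "b = f b'"
    and nodes: "a' \<in> nodes m N" "v' \<in> nodes m N" "b' \<in> nodes m N"
  proof -
    have "a \<in> f ` nodes m N" "v \<in> f ` nodes m N" "b \<in> f ` nodes m N"
      using arcs parcs_subset[OF pair_graph_node_graph] by (auto simp: node_graph_def)
    then show ?thesis
      using that by blast
  qed
  with arcs rank show "(a, b) \<in> parcs (node_graph f m N)"
    using node_arcs_rank_elim[of a' v' m N b'] by (auto simp: node_graph_parcs inv_into_f_f[OF inj])
qed

section \<open>Transporting spanning trees back to the vertices of the construction\<close>

definition pullback :: "'a pair_pre_digraph \<Rightarrow> node rel" where
  "pullback T = {(u, v). u \<in> nodes m N \<and> v \<in> nodes m N \<and> (f u, f v) \<in> parcs T}"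

text \<open>Injectivity of \<open>f\<close> carries connections off \<open>y\<close> to connections
  off \<open>f y\<close>. The colouring is found on the connected tree \<open>T\<close> and composed
  with \<open>f\<close>; the last claim lifts walks of \<open>T\<close>.\<close>

lemma pullback_forest:
  assumes "undirected_spanning_tree T (node_graph f m N)"
  shows "forest_rel (pullback T)" "pullback T \<subseteq> node_arcs m N"
    and "\<exists>col :: node \<Rightarrow> bool. \<forall>(u, v) \<in> pullback T. col u \<noteq> col v"
    and "\<And>u v n. \<lbrakk>u \<in> nodes m N; (f u, v) \<in> parcs T ^^ n\<rbrakk> \<Longrightarrow> \<exists>w. v = f w \<and> (u, w) \<in> pullback T ^^ n"
proof -
  have tree: "undirected_tree T" and conn: "connected_graph T" and T: "pair_graph T"
    and verts: "pverts T = f ` nodes m N" and sub: "parcs T \<subseteq> parcs (node_graph f m N)"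
    using assms unfolding undirected_spanning_tree_def undirected_tree_def connected_graph_def
      spanning_def subgraph_def by (auto simp: node_graph_def)
  have forest: "forest_rel (parcs T)"
    using tree by (rule undirected_tree_forest_rel)
  show "forest_rel (pullback T)"
    unfolding forest_rel_def
  proof (intro conjI allI impI notI)
    show "sym (pullback T)"
      using parcs_sym[OF T] unfolding pullback_def sym_def by blast
  next
    fix y a b
    assume ya: "(y, a) \<in> pullback T" and yb: "(y, b) \<in> pullback T" and "a \<noteq> b"
      and ab: "(a, b) \<in> (pullback T \<inter> (- {y}) \<times> (- {y}))\<^sup>*"
    have "(f a, f b) \<in> (parcs T \<inter> (- {f y}) \<times> (- {f y}))\<^sup>*"
    proof (rule rtrancl_map[OF ab])
      fix z w assume "(z, w) \<in> pullback T \<inter> (- {y}) \<times> (- {y})"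
      then show "(f z, f w) \<in> parcs T \<inter> (- {f y}) \<times> (- {f y})"
        using ya inj_onD[OF inj] unfolding pullback_def by blast
    qed
    then have "f a = f b"
      using forest_relD[OF forest] ya yb unfolding pullback_def by blast
    then show False
      using \<open>a \<noteq> b\<close> ya yb inj_onD[OF inj] unfolding pullback_def by blast
  qed
  show "pullback T \<subseteq> node_arcs m N"
    using sub node_graph_parcs unfolding pullback_def by blast
  obtain r where "r \<in> pverts T"
    using conn unfolding connected_graph_iff by blast
  moreover have "Field (parcs T) \<subseteq> pverts T"
    using parcs_subset[OF T] unfolding Field_def by blast
  ultimately have "\<exists>col :: 'a \<Rightarrow> bool. \<forall>(u, v) \<in> parcs T. col u \<noteq> col v"
    using conn unfolding connected_graph_iff
    by (intro forest_rel_bipartite[OF forest parcs_irrefl[OF T], of r]) blast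
  then obtain col :: "'a \<Rightarrow> bool" where "\<forall>(u, v) \<in> parcs T. col u \<noteq> col v" ..
  then show "\<exists>col :: node \<Rightarrow> bool. \<forall>(u, v) \<in> pullback T. col u \<noteq> col v"
    by (intro exI[of _ "col \<circ> f"]) (auto simp: pullback_def)
  show "\<exists>w. v = f w \<and> (u, w) \<in> pullback T ^^ n" if "u \<in> nodes m N" "(f u, v) \<in> parcs T ^^ n" for u v n
    using that(2)
  proof (induction n arbitrary: v)
    case 0
    then show ?case by auto
  next
    case (Suc n)
    then obtain z where z: "(f u, z) \<in> parcs T ^^ n" "(z, v) \<in> parcs T"
      by auto
    obtain z' where z': "z = f z'" "(u, z') \<in> pullback T ^^ n"
      using Suc.IH[OF z(1)] by blast
    have "z' \<in> nodes m N"
      using z'(2) that(1) by (cases n) (auto simp: pullback_def)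
    moreover obtain v' where "v = f v'" "v' \<in> nodes m N"
      using z(2) parcs_subset[OF T] verts by auto
    ultimately have "(z', v') \<in> pullback T"
      using z(2) z'(1) unfolding pullback_def by simp
    then show ?case
      using z'(2) \<open>v = f v'\<close> by auto
  qed
qed

end

theorem theorem10:
  fixes \<mu> :: nat
  assumes "\<mu> > 0"
  shows "\<exists>G :: nat pair_pre_digraph. connected_graph G \<and> chordal G \<and>
    \<not> (\<exists>\<T> :: nat pair_pre_digraph set. finite \<T> \<and> card \<T> \<le> \<mu> \<and> collectively_spans 3 \<T> G)"
proof -
  obtain m N where far: "\<forall>\<E>. finite \<E> \<longrightarrow> card \<E> \<le> \<mu> \<longrightarrow>
     (\<forall>E \<in> \<E>. forest_rel E \<and> E \<subseteq> node_arcs m N \<and> (\<exists>col :: node \<Rightarrow> bool. \<forall>(u, v) \<in> E. col u \<noteq> col v)) \<longrightarrow>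
     (\<exists>(u, v) \<in> node_arcs m N. \<forall>E \<in> \<E>. \<forall>n \<le> 4. (u, v) \<notin> E ^^ n)"
    using exists_far_adjacent_pair[OF assms] by (elim exE)
  obtain f :: "node \<Rightarrow> nat" where inj: "inj_on f (nodes m N)"
    using finite_imp_inj_to_nat_seg[OF finite_nodes] by blast
  let ?G = "node_graph f m N"
  have False if \<T>: "finite \<T>" "card \<T> \<le> \<mu>" and span: "collectively_spans 3 \<T> ?G" for \<T>
  proof -
    have trees: "undirected_spanning_tree T ?G" if "T \<in> \<T>" for T
      using span that unfolding collectively_spans_def by blast
    let ?\<E> = "pullback f m N ` \<T>"
    have "finite ?\<E>" "card ?\<E> \<le> \<mu>"
      using \<T> card_image_le[of \<T> "pullback f m N"] by auto
    moreover have "\<forall>E \<in> ?\<E>. forest_rel E \<and> E \<subseteq> node_arcs m N \<and>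
        (\<exists>col :: node \<Rightarrow> bool. \<forall>(u, v) \<in> E. col u \<noteq> col v)"
      using pullback_forest(1-3)[OF inj trees] by simp
    ultimately have "\<exists>(u, v) \<in> node_arcs m N. \<forall>E \<in> ?\<E>. \<forall>n \<le> 4. (u, v) \<notin> E ^^ n"
      using far[THEN spec, of ?\<E>] by simp
    then obtain u v where uv: "(u, v) \<in> node_arcs m N"
      and no_walk: "\<And>T n. \<lbrakk>T \<in> \<T>; n \<le> 4\<rbrakk> \<Longrightarrow> (u, v) \<notin> pullback f m N T ^^ n"
      by auto
    then have nodes: "u \<in> nodes m N" "v \<in> nodes m N"
      unfolding node_arcs_def by auto
    then have verts: "f u \<in> pverts ?G" "f v \<in> pverts ?G"
      unfolding node_graph_def by auto
    then obtain T where T: "T \<in> \<T>" "graph_dist T (f u) (f v) \<le> graph_dist ?G (f u) (f v) + 3"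
      using span unfolding collectively_spans_def by blast
    let ?n = "graph_dist T (f u) (f v)"
    \<comment> \<open>Adjacent vertices have distance at most 1, so the additive 3 allows at most 4,
      the length excluded by \<open>no_walk\<close>.\<close>
    have "graph_dist ?G (f u) (f v) \<le> 1"
      using graph_dist_adjacent[OF pair_graph_node_graph[OF inj]] node_graph_parcs[OF inj nodes] uv by blast
    then have "?n \<le> 4"
      using T(2) by linarith
    have conn: "connected_graph T" and "pverts T = pverts ?G"
      using trees[OF T(1)] unfolding undirected_spanning_tree_def undirected_tree_def spanning_def by auto
    then have "(f u, f v) \<in> parcs T ^^ ?n"
      using graph_dist_relpow[OF conn] verts by simp
    then obtain w where w: "f v = f w" "(u, w) \<in> pullback f m N T ^^ ?n"
      using pullback_forest(4)[OF inj trees[OF T(1)] nodes(1)] by blast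
    have "w \<in> nodes m N"
      using w(2) nodes(1) by (cases ?n) (auto simp: pullback_def[OF inj])
    then have "w = v"
      using inj_onD[OF inj] w(1) nodes(2) by simp
    then show False
      using no_walk[OF T(1) \<open>?n \<le> 4\<close>] w(2) by blast
  qed
  then show ?thesis
    using connected_node_graph[OF inj] chordal_node_graph[OF inj] by blast
qed

end
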